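(* Let $0\le m\le m'\le n$ and let $C_m^{m'}=\{S\subseteq[n]: m\le|S|\le m'\}$. Let $\mathcal B:=\mathcal S_m\cup\mathcal I_m\cup\mathcal I_{m+1}\cup\dots\cup\mathcal I_{m'}$ and let $\rho:\mathcal T(C_m^{m'})\to\mathbb R^{\mathcal B}$ be the restriction map. Then $\rho$ is a bijection, i.e. $\mathcal B$ is a TP-basis for $C_m^{m'}$. (When $m=0$, all functions in $\mathcal T(C_0^{m'})$ are assumed to satisfy $f(\emptyset)=0$.)
   Context: $[n]=\{1,\dots,n\}$ ordered naturally. For $X\subseteq[n]$ and distinct elements $i,j,\dots$ not in $X$, write $Xij\cdots$ for $X\cup\{i,j,\dots\}$. A function $f:C_m^{m'}\to\mathbb R$ is a TP-function if $f(Xik)+f(Xj)=\max\{f(Xij)+f(Xk),\ f(Xi)+f(Xjk)\}$ for all $i<j<k$ in $[n]$ and $X\subseteq[n]\setminus\{i,j,k\}$ such that all six sets occurring lie in $C_m^{m'}$, and $f(Xik)+f(Xj\ell)=\max\{f(Xij)+f(Xk\ell),\ f(Xi\ell)+f(Xjk)\}$ for all $i<j<k<\ell$ in $[n]$ and $X\subseteq[n]\setminus\{i,j,k,\ell\}$ such that all six sets occurring lie in $C_m^{m'}$. $\mathcal T(C_m^{m'})$ is the set of TP-functions. An interval is a set $[c..d]=\{c,c+1,\dots,d\}$; $\mathcal I_p$ is the set of $p$-element intervals in $[n]$. A sesqui-interval is a set $[1..d_1]\cup[c_2..d_2]$ with $1\le d_1$, $d_1+1<c_2\le d_2\le n$;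 $\mathcal S_p$ is the set of $p$-element sesqui-intervals. *)

theory Defs
  imports Complex_Main "HOL-Library.FuncSet"
begin

definition layers :: "nat \<Rightarrow> nat \<Rightarrow> nat \<Rightarrow> nat set set" where
  "layers n m m' = {S. S \<subseteq> {1..n} \<and> m \<le> card S \<and> card S \<le> m'}"

definition TP3 :: "nat \<Rightarrow> nat set set \<Rightarrow> (nat set \<Rightarrow> real) \<Rightarrow> bool" where
  "TP3 n C f \<longleftrightarrow>
    (\<forall>i j k X. i \<in> {1..n} \<and> j \<in> {1..n} \<and> k \<in> {1..n} \<and> i < j \<and> j < k \<and>
       X \<subseteq> {1..n} - {i, j, k} \<and>
       {X \<union> {i, k}, X \<union> {j}, X \<union> {i, j}, X \<union> {k}, X \<union> {i}, X \<union> {j, k}} \<subseteq> C \<longrightarrow>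
       f (X \<union> {i, k}) + f (X \<union> {j}) =
         max (f (X \<union> {i, j}) + f (X \<union> {k})) (f (X \<union> {i}) + f (X \<union> {j, k})))"

definition TP4 :: "nat \<Rightarrow> nat set set \<Rightarrow> (nat set \<Rightarrow> real) \<Rightarrow> bool" where
  "TP4 n C f \<longleftrightarrow>
    (\<forall>i j k l X. i \<in> {1..n} \<and> j \<in> {1..n} \<and> k \<in> {1..n} \<and> l \<in> {1..n} \<and>
       i < j \<and> j < k \<and> k < l \<and>
       X \<subseteq> {1..n} - {i, j, k, l} \<and>
       {X \<union> {i, k}, X \<union> {j, l}, X \<union> {i, j}, X \<union> {k, l}, X \<union> {i, l}, X \<union> {j, k}} \<subseteq> C \<longrightarrow>
       f (X \<union> {i, k}) + f (X \<union> {j, l}) =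
         max (f (X \<union> {i, j}) + f (X \<union> {k, l})) (f (X \<union> {i, l}) + f (X \<union> {j, k})))"

text \<open>
  Functions with domain \<open>C\<close> are represented by the extensional functions on \<open>C\<close>, so that equality
  of TP-functions is equality on \<open>C\<close>. For \<open>m = 0\<close> the normalization \<open>f {} = 0\<close> is imposed.
\<close>

definition TP_functions :: "nat \<Rightarrow> nat \<Rightarrow> nat \<Rightarrow> (nat set \<Rightarrow> real) set" where
  "TP_functions n m m' =
    {f \<in> layers n m m' \<rightarrow>\<^sub>E UNIV.
       TP3 n (layers n m m') f \<and> TP4 n (layers n m m') f \<and> (m = 0 \<longrightarrow> f {} = 0)}"

text \<open>
  Intervals are nonempty, so there are none of size 0. This matters for \<open>m = 0\<close>: the
  empty set, on which the value of \<open>f\<close> is normalized to 0, is not a coordinate of the basis.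
\<close>

definition intervals :: "nat \<Rightarrow> nat \<Rightarrow> nat set set" where
  "intervals n p = {S. \<exists>c d. 1 \<le> c \<and> c \<le> d \<and> d \<le> n \<and> S = {c..d} \<and> card S = p}"

definition sesqui_intervals :: "nat \<Rightarrow> nat \<Rightarrow> nat set set" where
  "sesqui_intervals n p =
    {S. \<exists>d1 c2 d2. 1 \<le> d1 \<and> d1 + 1 < c2 \<and> c2 \<le> d2 \<and> d2 \<le> n \<and>
       S = {1..d1} \<union> {c2..d2} \<and> card S = p}"

definition interval_basis :: "nat \<Rightarrow> nat \<Rightarrow> nat \<Rightarrow> nat set set" where
  "interval_basis n m m' = sesqui_intervals n m \<union> (\<Union>p\<in>{m..m'}. intervals n p)"

text \<open>\<open>B\<close> is a TP-basis if restriction to \<open>B\<close> is a bijection onto all real functions on \<open>B\<close>.\<close>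

definition TP_basis :: "nat \<Rightarrow> nat \<Rightarrow> nat \<Rightarrow> nat set set \<Rightarrow> bool" where
  "TP_basis n m m' B \<longleftrightarrow> B \<subseteq> layers n m m' \<and>
     bij_betw (\<lambda>f. restrict f B) (TP_functions n m m') (B \<rightarrow>\<^sub>E UNIV)"

end

(* Repeated use of the relations, solved for one of the two sets on the left, expresses every value
   of a TP-function through the values on the basis: a non-interval S = Xik in {i..k} with a gap j
   reduces to Xij, Xjk and the layer below, and sets of the lowest layer that contain 1 are handled
   like the layer below on {2..n}. This gives injectivity.

   For surjectivity, replace maximum and sum by sum and product: given h on the basis, for every t there is a positive
   solution P_t of the Pluecker relations with P_t = exp (t h) on the basis, namely the maximal minors
   of the top rows of a matrix, whose entries are found one at a time because an interval minor is
   affine in its bottom right entry. The same reduction shows that P_t is positive on all sets and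
   that ln P_t / t converges as t tends to infinity; the limit is a TP-function that extends h. *)
theory Submission imports Defs begin

section \<open>Generating every set of the layers from the basis\<close>

text \<open>Induction on the length of a window \<open>{a..b}\<close> containing the set. If an
  endpoint is missing, the window shrinks. Otherwise either the set fills the window or it omits
  some inner \<open>j\<close>, and then exchanging one endpoint for \<open>j\<close> gives two sets
  that fit into shorter windows. The lower layer does not occur in \<open>step\<close>; each
  application supplies the values there itself.\<close>

lemma layer_generation:
  fixes g n p :: nat
  assumes S: "S \<subseteq> {g..n}" "card S = Suc p"
    and int: "\<And>c d. g \<le> c \<Longrightarrow> c \<le> d \<Longrightarrow> d \<le> n \<Longrightarrow> card {c..d} = Suc p \<Longrightarrow> Q {c..d}"
    and step: "\<And>i j k X. g \<le> i \<Longrightarrow> i < j \<Longrightarrow> j < k \<Longrightarrow> k \<le> n \<Longrightarrow> X \<subseteq> {g..n} - {i, j, k} \<Longrightarrow>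
      card X + 1 = p \<Longrightarrow> Q (X \<union> {i, j}) \<Longrightarrow> Q (X \<union> {j, k}) \<Longrightarrow> Q (X \<union> {i, k})"
  shows "Q S"
proof -
  have "Q T" if "T \<subseteq> {a..b}" "card T = Suc p" "g \<le> a" "b \<le> n" for T a b
    using that
  proof (induction "Suc b - a" arbitrary: a b T rule: less_induct)
    case less
    have ne: "T \<noteq> {}" and fin: "finite T"
      using less.prems finite_subset by auto
    then have ab: "a \<le> b" using less.prems(1) by fastforce
    consider "T = {a..b}" | "a \<notin> T" | "b \<notin> T"
      | j where "a \<in> T" "b \<in> T" "j \<in> {a..b}" "j \<notin> T"
      using less.prems(1) by blast
    then show ?case
    proof cases
      case 1
      then show ?thesis using int ab less.prems by blast
    next
      case 2
      then have "T \<subseteq> {Suc a..b}"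
        using less.prems(1) by (metis atLeastAtMost_iff not_less_eq_eq le_antisym subsetD subsetI)
      then show ?thesis
        using less.hyps[of b "Suc a" T] less.prems ab by auto
    next
      case 3
      then have *: "T \<subseteq> {a..<b}"
        using less.prems(1) by (metis atLeastAtMost_iff atLeastLessThan_iff le_neq_implies_less subsetD subsetI)
      with ne have "a < b" by auto
      with * have "T \<subseteq> {a..b - 1}" by (auto simp: subset_iff)
      then show ?thesis
        using less.hyps[of "b - 1" a T] less.prems \<open>a < b\<close> by auto
    next
      case 4
      define X where "X = T - {a, b}"
      have j: "a < j" "j < b"
        using 4 by (metis atLeastAtMost_iff le_neq_implies_less)+
      have T: "T = X \<union> {a, b}" using 4 X_def by auto
      have X: "X \<subseteq> {Suc a..b - 1} - {j}"
        using less.prems(1) 4 j unfolding X_def by fastforce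
      have fX: "finite X" using fin X_def by simp
      have notin: "a \<notin> X" "b \<notin> X" "j \<notin> X" using X j by auto
      have "card T = card X + 2"
        unfolding T using fX notin j by (subst card_Un_disjoint) auto
      then have cX: "card X + 1 = p" using less.prems by simp
      have c1: "card (X \<union> {a, j}) = Suc p" "card (X \<union> {j, b}) = Suc p"
        using fX notin j cX by (subst card_Un_disjoint; auto)+
      have "Q (X \<union> {a, j})"
        by (rule less.hyps[of "b - 1" a]) (use X j less.prems c1 in auto)
      moreover have "Q (X \<union> {j, b})"
        by (rule less.hyps[of b "Suc a"]) (use X j less.prems c1 in auto)
      ultimately show ?thesis
        unfolding T using step[of a j b X] X j less.prems cX by fastforce
    qed
  qed
  from this[OF S] show ?thesis by simp
qed

text \<open>The two blocks may be empty, overlap or touch, so intervals that start at \<open>g\<close> are covered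
  twice; this makes the family stable under deleting \<open>g\<close>.\<close>

definition base_family :: "nat \<Rightarrow> nat \<Rightarrow> nat \<Rightarrow> nat set set" where
  "base_family g n m = {S. S \<subseteq> {g..n} \<and> card S = m \<and>
     ((\<exists>c d. S = {c..d}) \<or> (\<exists>d1 c2 d2. g \<le> d1 \<and> S = {g..d1} \<union> {c2..d2}))}"

text \<open>An interval turns into a two-block set with first block \<open>{g..g}\<close>, and a
  first block starting at \<open>Suc g\<close> is lengthened by one.\<close>

lemma base_family_insert:
  assumes "S \<in> base_family (Suc g) n m" "g \<le> n"
  shows "insert g S \<in> base_family g n (Suc m)"
proof -
  have "S \<subseteq> {Suc g..n}" "card S = m" using assms by (auto simp: base_family_def)
  then have "insert g S \<subseteq> {g..n}" "card (insert g S) = Suc m"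
    using assms(2) finite_subset[of S "{Suc g..n}"] by (auto simp: subset_iff card_insert_if)
  moreover have "\<exists>d1 c2 d2. g \<le> d1 \<and> insert g S = {g..d1} \<union> {c2..d2}"
  proof -
    consider c d where "S = {c..d}" | d1 c2 d2 where "Suc g \<le> d1" "S = {Suc g..d1} \<union> {c2..d2}"
      using assms by (auto simp: base_family_def)
    then show ?thesis
    proof cases
      case 1
      then have "insert g S = {g..g} \<union> {c..d}" by auto
      then show ?thesis by blast
    next
      case 2
      then have "insert g S = {g..d1} \<union> {c2..d2}" by auto
      with 2 show ?thesis by (meson Suc_leD)
    qed
  qed
  ultimately show ?thesis by (simp add: base_family_def)
qed

text \<open>Returns from the loose family to the sets of the definition: an empty second block, or
  one that overlaps or touches the first, leaves a single interval, and only separated blocks give a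
  sesqui-interval.\<close>

lemma base_family_cases:
  assumes "S \<in> base_family 1 n m"
  shows "S = {} \<and> m = 0 \<or> S \<in> intervals n m \<or> S \<in> sesqui_intervals n m"
proof (cases "S = {}")
  case True
  then show ?thesis using assms by (auto simp: base_family_def)
next
  case False
  have S: "S \<subseteq> {1..n}" "card S = m" using assms by (auto simp: base_family_def)
  have interval: ?thesis if "S = {c..d}" for c d
  proof -
    have "c \<le> d" using False that by auto
    then have "1 \<le> c" "d \<le> n" using S that by auto
    with that S \<open>c \<le> d\<close> show ?thesis unfolding intervals_def by blast
  qed
  consider c d where "S = {c..d}" | d1 c2 d2 where "1 \<le> d1" "S = {1..d1} \<union> {c2..d2}"
    using assms by (auto simp: base_family_def)
  then show ?thesis
  proof cases
    case 1
    then show ?thesis by (rule interval)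
  next
    case 2
    consider "d2 < c2" | "c2 \<le> d1 + 1" | "d1 + 1 < c2" "c2 \<le> d2" by linarith
    then show ?thesis
    proof cases
      case 1
      then show ?thesis using interval[of 1 d1] 2 by simp
    next
      case c: 2
      show ?thesis
      \<comment> \<open>A block starting at 0 would put 0 into \<open>S\<close>, so this case is
        contradictory. In the other case the two blocks merge.\<close>
      proof (cases "c2 = 0")
        case True
        then have "d2 < c2" using 2 S by force
        then show ?thesis using interval[of 1 d1] 2 by simp
      next
        case False
        then have "S = {1..max d1 d2}" using c 2 by auto
        then show ?thesis by (rule interval)
      qed
    next
      case 3
      then have "d2 \<le> n" using 2 S by auto
      with 2 3 S show ?thesis unfolding sesqui_intervals_def by blast
    qed
  qed
qed

text \<open>Induction on \<open>m\<close> with \<open>g\<close> varying. Sets that contain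
  \<open>g\<close> correspond, by deleting \<open>g\<close>, to layer \<open>m\<close> on
  \<open>{Suc g..n}\<close> and are covered by the induction hypothesis. For sets without
  \<open>g\<close>, the values at \<open>Xgi\<close>, \<open>Xgj\<close>, \<open>Xgk\<close> are
  then known, and the four-index relation with smallest index \<open>g\<close> acts as the
  three-index relation that \<open>layer_generation\<close> asks for.\<close>

lemma base_layer_generation:
  fixes g n m :: nat
  assumes S: "S \<subseteq> {g..n}" "card S = m"
    and base: "\<And>S. S \<in> base_family g n m \<Longrightarrow> Q S"
    and step: "\<And>i j k l X. g \<le> i \<Longrightarrow> i < j \<Longrightarrow> j < k \<Longrightarrow> k < l \<Longrightarrow> l \<le> n \<Longrightarrow>
      X \<subseteq> {g..n} - {i, j, k, l} \<Longrightarrow> card X + 2 = m \<Longrightarrow>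
      Q (X \<union> {i, k}) \<Longrightarrow> Q (X \<union> {i, j}) \<Longrightarrow> Q (X \<union> {k, l}) \<Longrightarrow> Q (X \<union> {i, l}) \<Longrightarrow>
      Q (X \<union> {j, k}) \<Longrightarrow> Q (X \<union> {j, l})"
  shows "Q S"
  using assms
proof (induction m arbitrary: g S Q)
  case 0
  then have "S = {}" using finite_subset by fastforce
  then have "S = {1..0}" by simp
  then have "S \<in> base_family g n 0"
    unfolding base_family_def by auto
  then show ?case using 0 by blast
next
  case (Suc m)
  have "S \<noteq> {}" using Suc.prems(2) by auto
  then have gn: "g \<le> n" using Suc.prems(1) by fastforce
  have low: "Q (insert g T)" if "T \<subseteq> {Suc g..n}" "card T = m" for T
  proof (rule Suc.IH[of T "Suc g" "\<lambda>T. Q (insert g T)"])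
    show "Q (insert g T)" if "T \<in> base_family (Suc g) n m" for T
      using Suc.prems(3) base_family_insert[OF that gn] by blast
  next
    fix i j k l X
    assume *: "Suc g \<le> i" "i < j" "j < k" "k < l" "l \<le> n" "X \<subseteq> {Suc g..n} - {i, j, k, l}" "card X + 2 = m"
      "Q (insert g (X \<union> {i, k}))" "Q (insert g (X \<union> {i, j}))" "Q (insert g (X \<union> {k, l}))"
      "Q (insert g (X \<union> {i, l}))" "Q (insert g (X \<union> {j, k}))"
    have "finite X" using *(6) finite_subset by blast
    moreover have "g \<notin> X" using *(6) by auto
    ultimately have "card (insert g X) + 2 = Suc m" using *(7) by simp
    moreover have "insert g X \<subseteq> {g..n} - {i, j, k, l}"
      using *(1-6) by (auto simp: subset_iff)
    ultimately have "Q (insert g X \<union> {j, l})"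
      using Suc.prems(4)[of i j k l "insert g X"] * by (simp add: insert_commute)
    then show "Q (insert g (X \<union> {j, l}))" by (simp add: insert_commute)
  qed (use that in auto)
  show ?case
  proof (cases "g \<in> S")
    case True
    have "S - {g} \<subseteq> {Suc g..n}" using Suc.prems(1) by fastforce
    moreover have "card (S - {g}) = m"
      using True Suc.prems(2) by (simp add: card_Diff_singleton)
    ultimately have "Q (insert g (S - {g}))" by (rule low)
    then show ?thesis using True by (simp add: insert_absorb)
  next
    case False
    then have sub: "S \<subseteq> {Suc g..n}"
      using Suc.prems(1) by (metis atLeastAtMost_iff not_less_eq_eq le_antisym subsetD subsetI)
    show ?thesis
    proof (rule layer_generation[of S "Suc g" n m Q])
      show "Q {c..d}" if "Suc g \<le> c" "c \<le> d" "d \<le> n" "card {c..d} = Suc m" for c d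
        by (rule Suc.prems(3)) (use that in \<open>auto simp: base_family_def\<close>)
    next
      fix i j k X
      assume *: "Suc g \<le> i" "i < j" "j < k" "k \<le> n" "X \<subseteq> {Suc g..n} - {i, j, k}" "card X + 1 = m"
        "Q (X \<union> {i, j})" "Q (X \<union> {j, k})"
      have fX: "finite X" using *(5) finite_subset by blast
      have "Q (insert g (insert x X))" if "x \<in> {i, j, k}" for x
        by (rule low) (use that fX * in \<open>auto simp: card_insert_if\<close>)
      then have "Q (X \<union> {g, i})" "Q (X \<union> {g, j})" "Q (X \<union> {g, k})" by auto
      moreover have "X \<subseteq> {g..n} - {g, i, j, k}" using *(5) by fastforce
      ultimately show "Q (X \<union> {i, k})"
        using Suc.prems(4)[of g i j k X] * by simp
    qed (use sub Suc.prems in auto)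
  qed
qed

text \<open>Layer \<open>0\<close> is generated by the empty set, which the basis omits because it is normalized.\<close>

lemma layers_generation:
  assumes S: "S \<in> layers n m m'"
    and empty: "m = 0 \<Longrightarrow> Q {}"
    and base: "\<And>S. S \<in> interval_basis n m m' \<Longrightarrow> Q S"
    and step3: "\<And>i j k X. 1 \<le> i \<Longrightarrow> i < j \<Longrightarrow> j < k \<Longrightarrow> k \<le> n \<Longrightarrow> X \<subseteq> {1..n} - {i, j, k} \<Longrightarrow>
      m \<le> card X + 1 \<Longrightarrow> card X + 2 \<le> m' \<Longrightarrow> Q (X \<union> {j}) \<Longrightarrow> Q (X \<union> {i, j}) \<Longrightarrow> Q (X \<union> {k}) \<Longrightarrow>
      Q (X \<union> {i}) \<Longrightarrow> Q (X \<union> {j, k}) \<Longrightarrow> Q (X \<union> {i, k})"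
    and step4: "\<And>i j k l X. 1 \<le> i \<Longrightarrow> i < j \<Longrightarrow> j < k \<Longrightarrow> k < l \<Longrightarrow> l \<le> n \<Longrightarrow>
      X \<subseteq> {1..n} - {i, j, k, l} \<Longrightarrow> m \<le> card X + 2 \<Longrightarrow> card X + 2 \<le> m' \<Longrightarrow>
      Q (X \<union> {i, k}) \<Longrightarrow> Q (X \<union> {i, j}) \<Longrightarrow> Q (X \<union> {k, l}) \<Longrightarrow> Q (X \<union> {i, l}) \<Longrightarrow>
      Q (X \<union> {j, k}) \<Longrightarrow> Q (X \<union> {j, l})"
  shows "Q S"
proof -
  have *: "Q T" if "T \<subseteq> {1..n}" "card T = p" "m \<le> p" "p \<le> m'" for T p
    using that(3,4,1,2)
  proof (induction p arbitrary: T rule: dec_induct)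
    case base
    show ?case
    proof (rule base_layer_generation[of T 1 n m Q])
      fix S assume S: "S \<in> base_family 1 n m"
      have "m \<in> {m..m'}" using that by simp
      then show "Q S"
        using base_family_cases[OF S] empty assms(3)[of S] unfolding interval_basis_def by blast
    qed (use base step4 in auto)
  next
    case (step p)
    show ?case
    proof (rule layer_generation[of T 1 n p Q])
      show "Q {c..d}" if "1 \<le> c" "c \<le> d" "d \<le> n" "card {c..d} = Suc p" for c d
        by (rule assms(3)) (use that step in \<open>auto simp: interval_basis_def intervals_def intro!: bexI[of _ "Suc p"]\<close>)
    next
      fix i j k X
      assume *: "1 \<le> i" "i < j" "j < k" "k \<le> n" "X \<subseteq> {1..n} - {i, j, k}" "card X + 1 = p"
        "Q (X \<union> {i, j})" "Q (X \<union> {j, k})"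
      have fX: "finite X" using *(5) finite_subset by blast
      have "Q (insert x X)" if "x \<in> {i, j, k}" for x
        by (rule step.IH) (use that fX * step in \<open>auto simp: card_insert_if\<close>)
      then have "Q (X \<union> {i})" "Q (X \<union> {j})" "Q (X \<union> {k})" by auto
      then show "Q (X \<union> {i, k})"
        using step3[of i j k X] * step by simp
    qed (use step in auto)
  qed
  show ?thesis using * S by (auto simp: layers_def)
qed


section \<open>Pluecker relations and appending a row to a matrix\<close>

text \<open>The relations are indexed by layer so that a new layer can be put on top of old ones,
  and by the ground set \<open>G\<close> because the induction removes the smallest element. Here
  \<open>p\<close> is the lower of the two layers involved.\<close>

definition Plucker3 :: "nat set \<Rightarrow> nat \<Rightarrow> (nat set \<Rightarrow> real) \<Rightarrow> bool" where
  "Plucker3 G p P \<longleftrightarrow> (\<forall>i j k X. i < j \<and> j < k \<and> {i, j, k} \<subseteq> G \<and> X \<subseteq> G - {i, j, k} \<and> card X + 1 = p \<longrightarrow>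
     P (X \<union> {i, k}) * P (X \<union> {j}) = P (X \<union> {i, j}) * P (X \<union> {k}) + P (X \<union> {i}) * P (X \<union> {j, k}))"

definition Plucker4 :: "nat set \<Rightarrow> nat \<Rightarrow> (nat set \<Rightarrow> real) \<Rightarrow> bool" where
  "Plucker4 G p P \<longleftrightarrow> (\<forall>i j k l X. i < j \<and> j < k \<and> k < l \<and> {i, j, k, l} \<subseteq> G \<and>
     X \<subseteq> G - {i, j, k, l} \<and> card X + 2 = p \<longrightarrow>
     P (X \<union> {i, k}) * P (X \<union> {j, l}) =
       P (X \<union> {i, j}) * P (X \<union> {k, l}) + P (X \<union> {i, l}) * P (X \<union> {j, k}))"

lemma Plucker3D:
  assumes "Plucker3 G p P" "i < j" "j < k" "{i, j, k} \<subseteq> G" "X \<subseteq> G - {i, j, k}" "card X + 1 = p"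
  shows "P (X \<union> {i, k}) * P (X \<union> {j}) = P (X \<union> {i, j}) * P (X \<union> {k}) + P (X \<union> {i}) * P (X \<union> {j, k})"
  by (rule assms(1)[unfolded Plucker3_def, rule_format]) (use assms in blast)

lemma Plucker4D:
  assumes "Plucker4 G p P" "i < j" "j < k" "k < l" "{i, j, k, l} \<subseteq> G" "X \<subseteq> G - {i, j, k, l}" "card X + 2 = p"
  shows "P (X \<union> {i, k}) * P (X \<union> {j, l}) =
    P (X \<union> {i, j}) * P (X \<union> {k, l}) + P (X \<union> {i, l}) * P (X \<union> {j, k})"
  by (rule assms(1)[unfolded Plucker4_def, rule_format]) (use assms in blast)

text \<open>If \<open>P\<close> lists the maximal minors of a matrix by their column sets, this is
  the Laplace expansion along an appended bottom row \<open>A\<close>; the sign counts the columns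
  to the right of \<open>s\<close>. It is the exterior product of \<open>P\<close> with the vector
  \<open>A\<close>.\<close>

definition wedge :: "(nat \<Rightarrow> real) \<Rightarrow> (nat set \<Rightarrow> real) \<Rightarrow> nat set \<Rightarrow> real" where
  "wedge A P S = (\<Sum>s\<in>S. (- 1) ^ card {t \<in> S. s < t} * A s * P (S - {s}))"

text \<open>The expansion is split into \<open>s = a\<close>, \<open>s = b\<close> and
  \<open>s\<close> in \<open>X\<close>. Each of \<open>a\<close> and \<open>b\<close> that lies to
  the right of \<open>s\<close> flips the sign once; this accounts for the minus in the term of
  \<open>a\<close>, since \<open>a < b\<close>.\<close>

lemma wedge_two:
  assumes "finite X" "a < b" "a \<notin> X" "b \<notin> X"
  shows "wedge A P (X \<union> {a, b}) =
    (\<Sum>s\<in>X. (- 1) ^ card {t \<in> X. s < t} * (if s < a then - 1 else 1) * (if s < b then - 1 else 1)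
        * A s * P ((X - {s}) \<union> {a, b}))
    - (- 1) ^ card {t \<in> X. a < t} * A a * P (X \<union> {b}) + (- 1) ^ card {t \<in> X. b < t} * A b * P (X \<union> {a})"
proof -
  have card: "card {t \<in> X \<union> {a, b}. s < t} =
      card {t \<in> X. s < t} + (if s < a then 1 else 0) + (if s < b then 1 else 0)" for s
  proof -
    have "{t \<in> X \<union> {a, b}. s < t} = {t \<in> X. s < t} \<union> ((if s < a then {a} else {}) \<union> (if s < b then {b} else {}))"
      by auto
    also have "card \<dots> = card {t \<in> X. s < t} + card ((if s < a then {a} else {}) \<union> (if s < b then {b} else {}))"
      using assms by (subst card_Un_disjoint) auto
    finally show ?thesis using assms(2) by auto
  qed
  have set: "X \<union> {a, b} - {s} = (X - {s}) \<union> {a, b}" if "s \<in> X" for s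
    using that assms by auto
  have "X \<union> {a, b} - {a} = X \<union> {b}" "X \<union> {a, b} - {b} = X \<union> {a}" using assms by auto
  moreover have "wedge A P (X \<union> {a, b}) =
      (\<Sum>s\<in>X. (- 1) ^ card {t \<in> X \<union> {a, b}. s < t} * A s * P (X \<union> {a, b} - {s}))
      + (\<Sum>s\<in>{a, b}. (- 1) ^ card {t \<in> X \<union> {a, b}. s < t} * A s * P (X \<union> {a, b} - {s}))"
    unfolding wedge_def using assms by (subst sum.union_disjoint) auto
  moreover have "(- 1 :: real) ^ (if b then 1 else 0) = (if b then - 1 else 1)" for b by simp
  ultimately show ?thesis
    unfolding card power_add using assms set by (simp cong: sum.cong)
qed

text \<open>Both sides are linear in \<open>A\<close>, so coefficients can be compared. Those of
  \<open>A i\<close>, \<open>A j\<close> and \<open>A k\<close> agree at once, and for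
  \<open>s\<close> in \<open>X\<close> the coefficients of \<open>A s\<close> agree by the
  four-index relation for \<open>X - {s}\<close> and the indices \<open>i\<close>, \<open>j\<close>,
  \<open>k\<close>, \<open>s\<close>.\<close>

lemma wedge_Plucker3:
  assumes P: "Plucker4 G p P" "finite G"
    and ijk: "i < j" "j < k" "{i, j, k} \<subseteq> G" "X \<subseteq> G - {i, j, k}" "card X + 1 = p"
  shows "wedge A P (X \<union> {i, k}) * P (X \<union> {j}) =
    wedge A P (X \<union> {i, j}) * P (X \<union> {k}) + P (X \<union> {i}) * wedge A P (X \<union> {j, k})"
proof -
  have fX: "finite X" using P(2) ijk(4) finite_subset by blast
  have n: "i \<notin> X" "j \<notin> X" "k \<notin> X" using ijk(4) by auto
  define e where "e s = (- 1 :: real) ^ card {t \<in> X. s < t}" for s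
  define \<epsilon> where "\<epsilon> s a = (if s < a then - 1 else 1 :: real)" for s a :: nat
  define Z where "Z a b = (\<Sum>s\<in>X. e s * \<epsilon> s a * \<epsilon> s b * A s * P ((X - {s}) \<union> {a, b}))" for a b
  have w: "wedge A P (X \<union> {a, b}) = Z a b - e a * A a * P (X \<union> {b}) + e b * A b * P (X \<union> {a})"
    if "a < b" "a \<notin> X" "b \<notin> X" for a b
    unfolding Z_def e_def \<epsilon>_def using wedge_two[OF fX that] .
  \<comment> \<open>The sign \<open>e s\<close> is common to all terms, so only the position of
    \<open>s\<close> among \<open>i < j < k\<close> matters. The four positions give the four-index
    relation with its terms distributed differently over the two sides.\<close>
  have summand: "\<epsilon> s i * \<epsilon> s k * P (X - {s} \<union> {i, k}) * P (X \<union> {j}) =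
      \<epsilon> s i * \<epsilon> s j * P (X - {s} \<union> {i, j}) * P (X \<union> {k}) +
      P (X \<union> {i}) * (\<epsilon> s j * \<epsilon> s k * P (X - {s} \<union> {j, k}))" if s: "s \<in> X" for s
  proof -
    define Y where "Y = X - {s}"
    have X: "X = insert s Y" "s \<notin> Y" using s Y_def by auto
    have Y: "Y \<subseteq> G - {i, j, k, s}" "card Y + 2 = p" "s \<in> G"
      using X fX ijk(4,5) by auto
    have P4: "P (Y \<union> {a, c}) * P (Y \<union> {b, d}) =
        P (Y \<union> {a, b}) * P (Y \<union> {c, d}) + P (Y \<union> {a, d}) * P (Y \<union> {b, c})"
      if "a < b" "b < c" "c < d" "{a, b, c, d} = {i, j, k, s}" for a b c d
    proof -
      have "{a, b, c, d} \<subseteq> G" "Y \<subseteq> G - {a, b, c, d}"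
        using that(4) ijk(3) Y by auto
      with Plucker4D[OF P(1) that(1-3) _ _ Y(2)] show ?thesis by blast
    qed
    have U: "X \<union> {x} = Y \<union> {s, x}" for x using X by auto
    have com: "Y \<union> {x, s} = Y \<union> {s, x}" for x by auto
    have "s \<noteq> i" "s \<noteq> j" "s \<noteq> k" using s n by auto
    then consider "s < i" | "i < s" "s < j" | "j < s" "s < k" | "k < s" by linarith
    then show ?thesis
    proof cases
      case 1
      then have "{s, i, j, k} = {i, j, k, s}" by auto
      from P4[OF 1 ijk(1,2) this] 1 ijk(1,2) show ?thesis
        unfolding U \<epsilon>_def Y_def[symmetric] by (simp add: mult.commute)
    next
      case 2
      then have "{i, s, j, k} = {i, j, k, s}" by auto
      from P4[OF 2 ijk(2) this] 2 ijk(1,2) show ?thesis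
        unfolding U \<epsilon>_def Y_def[symmetric] com by (simp add: algebra_simps)
    next
      case 3
      then have "{i, j, s, k} = {i, j, k, s}" by auto
      from P4[OF ijk(1) 3 this] 3 ijk(1,2) show ?thesis
        unfolding U \<epsilon>_def Y_def[symmetric] com by (simp add: algebra_simps)
    next
      case 4
      from P4[OF ijk(1,2) 4 refl] 4 ijk(1,2) show ?thesis
        unfolding U \<epsilon>_def Y_def[symmetric] com by (simp add: algebra_simps)
    qed
  qed
  have "Z i k * P (X \<union> {j}) = (\<Sum>s\<in>X. e s * A s * (\<epsilon> s i * \<epsilon> s k * P (X - {s} \<union> {i, k}) * P (X \<union> {j})))"
    unfolding Z_def sum_distrib_right by (simp add: algebra_simps)
  also have "\<dots> = (\<Sum>s\<in>X. e s * A s * (\<epsilon> s i * \<epsilon> s j * P (X - {s} \<union> {i, j}) * P (X \<union> {k}) +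
      P (X \<union> {i}) * (\<epsilon> s j * \<epsilon> s k * P (X - {s} \<union> {j, k}))))"
    using summand by (intro sum.cong) auto
  also have "\<dots> = Z i j * P (X \<union> {k}) + P (X \<union> {i}) * Z j k"
    unfolding Z_def sum_distrib_right sum_distrib_left sum.distrib[symmetric]
    by (simp add: algebra_simps)
  finally have "Z i k * P (X \<union> {j}) = Z i j * P (X \<union> {k}) + P (X \<union> {i}) * Z j k" .
  moreover have "i < k" using ijk by simp
  ultimately show ?thesis
    unfolding w[OF ijk(1) n(1,2)] w[OF ijk(2) n(2,3)] w[OF \<open>i < k\<close> n(1,3)] by (simp add: algebra_simps)
qed

text \<open>With \<open>u\<^sub>b = P(Xib)\<close> and \<open>v\<^sub>b = P(Xb)\<close>, the relations \<open>u\<^sub>cv\<^sub>b = u\<^sub>bv\<^sub>c + v\<^sub>iP(Xbc)\<close> express \<open>P(Xbc)\<close>,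
  up to the factor \<open>v\<^sub>i\<close>, as a \<open>2 \<times> 2\<close> minor, and these minors satisfy the four-index relation.\<close>

lemma Plucker4_step:
  assumes P: "\<And>S. S \<subseteq> G \<Longrightarrow> card S = p \<Longrightarrow> 0 < P S" and P3: "Plucker3 G p P" and G: "finite G"
  shows "Plucker4 G (Suc p) P"
  unfolding Plucker4_def
proof (intro allI impI; elim conjE)
  fix i j k l X
  assume *: "i < j" "j < k" "k < l" "{i, j, k, l} \<subseteq> G" "X \<subseteq> G - {i, j, k, l}" "card X + 2 = Suc p"
  have fX: "finite X" using G *(5) finite_subset by blast
  have "0 < P (X \<union> {i})" using * fX by (intro P) (auto simp: card_insert_if)
  moreover have "P (X \<union> {i, c}) * P (X \<union> {b}) = P (X \<union> {i, b}) * P (X \<union> {c}) + P (X \<union> {i}) * P (X \<union> {b, c})"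
    if "b < c" "i < b" "b \<in> {j, k, l}" "c \<in> {j, k, l}" for b c
  proof -
    have "{i, b, c} \<subseteq> G" "X \<subseteq> G - {i, b, c}" "card X + 1 = p" using that * by auto
    with P3 that(2,1) show ?thesis by (rule Plucker3D)
  qed
  from this[of j k] this[of j l] this[of k l]
  have "P (X \<union> {i, k}) * P (X \<union> {j}) = P (X \<union> {i, j}) * P (X \<union> {k}) + P (X \<union> {i}) * P (X \<union> {j, k})"
   "P (X \<union> {i, l}) * P (X \<union> {j}) = P (X \<union> {i, j}) * P (X \<union> {l}) + P (X \<union> {i}) * P (X \<union> {j, l})"
   "P (X \<union> {i, l}) * P (X \<union> {k}) = P (X \<union> {i, k}) * P (X \<union> {l}) + P (X \<union> {i}) * P (X \<union> {k, l})"
    using * by auto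
  moreover have "uk * Ujl = uj * Ukl + ul * Ujk"
    if "0 < vi" "uk * vj = uj * vk + vi * Ujk" "ul * vj = uj * vl + vi * Ujl" "ul * vk = uk * vl + vi * Ukl"
    for vi vj vk vl uj uk ul Ujk Ujl Ukl :: real
  proof -
    have "vi * (uk * Ujl) = uk * (ul * vj - uj * vl)" using that(3) by (simp add: algebra_simps)
    \<comment> \<open>This is the vanishing of the determinant with rows \<open>u\<close>,
      \<open>u\<close>, \<open>v\<close> and columns \<open>j\<close>, \<open>k\<close>,
      \<open>l\<close>.\<close>
    also have "\<dots> = uj * (ul * vk - uk * vl) + ul * (uk * vj - uj * vk)" by (simp add: algebra_simps)
    also have "\<dots> = uj * (vi * Ukl) + ul * (vi * Ujk)" using that(2,4) by simp
    also have "\<dots> = vi * (uj * Ukl + ul * Ujk)" by (simp add: algebra_simps)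
    finally show ?thesis using that(1) by simp
  qed
  ultimately show "P (X \<union> {i, k}) * P (X \<union> {j, l}) =
      P (X \<union> {i, j}) * P (X \<union> {k, l}) + P (X \<union> {i, l}) * P (X \<union> {j, k})" by blast
qed

section \<open>Positive extension by one layer with prescribed values on intervals\<close>

text \<open>The value at \<open>{d - p..d}\<close> involves only entries of \<open>A\<close> up to
  \<open>d\<close>, and the coefficient of \<open>A d\<close> is \<open>P {d - p..<d}\<close>, which
  is positive. Hence the entries can be solved for one after another as \<open>d\<close>
  increases.\<close>

lemma wedge_interpolation:
  assumes P: "\<And>S. S \<subseteq> {g..n} \<Longrightarrow> card S = p \<Longrightarrow> 0 < P S"
  obtains A where "\<And>d. g + p \<le> d \<Longrightarrow> d \<le> n \<Longrightarrow> wedge A P {d - p..d} = h {d - p..d}"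
proof -
  have "\<exists>A. \<forall>d<N. g + p \<le> d \<and> d \<le> n \<longrightarrow> wedge A P {d - p..d} = h {d - p..d}" for N
  proof (induction N)
    case (Suc N)
    then obtain A where A: "\<And>d. d < N \<Longrightarrow> g + p \<le> d \<Longrightarrow> d \<le> n \<Longrightarrow> wedge A P {d - p..d} = h {d - p..d}"
      by blast
    \<comment> \<open>The contribution of the entries left of \<open>N\<close>; changing
      \<open>A N\<close> leaves it alone, as well as all equations already solved.\<close>
    define r where "r = (\<Sum>s\<in>{N - p..<N}. (- 1) ^ card {t \<in> {N - p..N}. s < t} * A s * P ({N - p..N} - {s}))"
    define A' where "A' = A(N := (h {N - p..N} - r) / P {N - p..<N})"
    have "wedge A' P {d - p..d} = h {d - p..d}" if "d < Suc N" "g + p \<le> d" "d \<le> n" for d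
    proof (cases "d = N")
      case True
      have "P {N - p..<N} > 0" using that True by (intro P) auto
      have ins: "{N - p..N} = insert N {N - p..<N}" by auto
      have "wedge A' P {N - p..N} = (\<Sum>s\<in>{N - p..<N}. (- 1) ^ card {t \<in> {N - p..N}. s < t} * A' s * P ({N - p..N} - {s}))
          + (- 1) ^ card {t \<in> {N - p..N}. N < t} * A' N * P ({N - p..N} - {N})"
        unfolding wedge_def by (subst (2) ins) (simp add: add.commute)
      also have "{t \<in> {N - p..N}. N < t} = {}" by auto
      also have "{N - p..N} - {N} = {N - p..<N}" by auto
      also have "(\<Sum>s\<in>{N - p..<N}. (- 1) ^ card {t \<in> {N - p..N}. s < t} * A' s * P ({N - p..N} - {s})) = r"
        unfolding r_def A'_def by (intro sum.cong) auto
      moreover have "A' N = (h {N - p..N} - r) / P {N - p..<N}" by (simp add: A'_def)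
      ultimately show ?thesis using True \<open>P {N - p..<N} > 0\<close> by simp
    next
      case False
      then have "wedge A' P {d - p..d} = wedge A P {d - p..d}"
        unfolding wedge_def A'_def using that by (intro sum.cong) auto
      then show ?thesis using A that False by auto
    qed
    then show ?case by blast
  qed auto
  from this[of "Suc n"] obtain A where "\<forall>d<Suc n. g + p \<le> d \<and> d \<le> n \<longrightarrow> wedge A P {d - p..d} = h {d - p..d}" ..
  then show thesis by (intro that[of A]) auto
qed

text \<open>\<open>U\<close> keeps \<open>P\<close> and fills layer \<open>Suc p\<close> with the
  minors after one more row, so the three-index relation holds. Solved for \<open>Xik\<close> it is
  free of subtraction, so positivity spreads from the intervals to the whole layer. Positivity on
  layer \<open>p\<close> lets \<open>Plucker4_step\<close> supply the four-index relation, so the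
  construction can be repeated.\<close>

lemma layer_extension:
  fixes P h :: "nat set \<Rightarrow> real"
  assumes P: "\<And>S. S \<subseteq> {g..n} \<Longrightarrow> card S = p \<Longrightarrow> 0 < P S" and P4: "Plucker4 {g..n} p P"
    and h: "\<And>S. 0 < h S"
  obtains U where "\<And>S. card S \<noteq> Suc p \<Longrightarrow> U S = P S"
    "\<And>S. S \<subseteq> {g..n} \<Longrightarrow> card S = Suc p \<Longrightarrow> 0 < U S"
    "Plucker3 {g..n} p U" "Plucker4 {g..n} (Suc p) U"
    "\<And>c d. g \<le> c \<Longrightarrow> d \<le> n \<Longrightarrow> card {c..d} = Suc p \<Longrightarrow> U {c..d} = h {c..d}"
proof -
  obtain A where A: "\<And>d. g + p \<le> d \<Longrightarrow> d \<le> n \<Longrightarrow> wedge A P {d - p..d} = h {d - p..d}"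
    using wedge_interpolation[of g n p P h] P by blast
  define U where "U S = (if card S = Suc p then wedge A P S else P S)" for S
  have same: "U S = P S" if "card S \<noteq> Suc p" for S using that by (simp add: U_def)
  have P3: "Plucker3 {g..n} p U"
    unfolding Plucker3_def
  proof (intro allI impI; elim conjE)
    fix i j k X
    assume *: "i < j" "j < k" "{i, j, k} \<subseteq> {g..n}" "X \<subseteq> {g..n} - {i, j, k}" "card X + 1 = p"
    have fX: "finite X" using *(4) finite_subset by blast
    have "card (X \<union> {i, j}) = Suc p" "card (X \<union> {j, k}) = Suc p" "card (X \<union> {i, k}) = Suc p"
      "card (X \<union> {i}) = p" "card (X \<union> {j}) = p" "card (X \<union> {k}) = p"
      using * fX by (auto simp: card_insert_if)
    then show "U (X \<union> {i, k}) * U (X \<union> {j}) = U (X \<union> {i, j}) * U (X \<union> {k}) + U (X \<union> {i}) * U (X \<union> {j, k})"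
      unfolding U_def using wedge_Plucker3[OF P4 _ *] by simp
  qed
  have Uint: "U {c..d} = h {c..d}" if "g \<le> c" "d \<le> n" "card {c..d} = Suc p" for c d
  proof -
    have "d - p = c" "g + p \<le> d" using that by auto
    then show ?thesis using A[of d] that by (simp add: U_def)
  qed
  have U0: "0 < U S" if "S \<subseteq> {g..n}" "card S = p" for S
    using same P that by simp
  have pos: "0 < U S" if "S \<subseteq> {g..n}" "card S = Suc p" for S
  proof (rule layer_generation[OF that])
    fix i j k X
    assume *: "g \<le> i" "i < j" "j < k" "k \<le> n" "X \<subseteq> {g..n} - {i, j, k}" "card X + 1 = p"
      and U: "0 < U (X \<union> {i, j})" "0 < U (X \<union> {j, k})"
    have fX: "finite X" using *(5) finite_subset by blast
    have "0 < U (X \<union> {x})" if "x \<in> {i, j, k}" for x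
      using that * fX by (intro U0) (auto simp: card_insert_if)
    then have x: "0 < U (X \<union> {i})" "0 < U (X \<union> {j})" "0 < U (X \<union> {k})" by auto
    have "{i, j, k} \<subseteq> {g..n}" using * by auto
    from Plucker3D[OF P3 *(2,3) this *(5,6)] have "U (X \<union> {i, k}) * U (X \<union> {j}) = U (X \<union> {i, j}) * U (X \<union> {k}) + U (X \<union> {i}) * U (X \<union> {j, k})" .
    also have "\<dots> > 0" using U x by (intro add_pos_pos mult_pos_pos)
    finally show "0 < U (X \<union> {i, k})" using x(2) by (simp add: zero_less_mult_iff)
  qed (use Uint h in auto)
  show thesis
    using that[of U] same pos P3 Uint Plucker4_step[of "{g..n}" p U, OF U0 P3] by blast
qed

section \<open>Positive solutions with prescribed basis values\<close>

lemma base_family_remove: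
  assumes "S \<in> base_family g n (Suc m)" "g \<in> S"
  shows "S - {g} \<in> base_family (Suc g) n m"
proof -
  have S: "S \<subseteq> {g..n}" "card S = Suc m" using assms by (auto simp: base_family_def)
  then have "S - {g} \<subseteq> {Suc g..n}" "card (S - {g}) = m"
    using assms(2) by (fastforce, simp add: card_Diff_singleton)
  moreover have "(\<exists>c d. S - {g} = {c..d}) \<or> (\<exists>d1 c2 d2. Suc g \<le> d1 \<and> S - {g} = {Suc g..d1} \<union> {c2..d2})"
  proof -
    have ge: "x \<ge> g" if "x \<in> S" for x using S that by auto
    consider c d where "S = {c..d}" | d1 c2 d2 where "g \<le> d1" "S = {g..d1} \<union> {c2..d2}"
      using assms by (auto simp: base_family_def)
    then show ?thesis
    proof cases
      case 1
      then have "S - {g} = {Suc g..d}" using ge assms(2) by force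
      then show ?thesis by blast
    next
      case 2
      \<comment> \<open>The second block may itself start at \<open>g\<close>, so it has to be
        truncated as well. If the first block is \<open>{g}\<close>, nothing of it survives and an
        interval remains.\<close>
      have *: "S - {g} = {Suc g..d1} \<union> {max (Suc g) c2..d2}"
      proof (rule set_eqI)
        show "x \<in> S - {g} \<longleftrightarrow> x \<in> {Suc g..d1} \<union> {max (Suc g) c2..d2}" for x
          using ge[of x] unfolding 2(2) by auto
      qed
      show ?thesis
      proof (cases "d1 = g")
        case True
        then have "S - {g} = {max (Suc g) c2..d2}" using * by simp
        then show ?thesis by blast
      next
        case False
        then show ?thesis using * 2 by (metis Suc_leI le_neq_implies_less)
      qed
    qed
  qed
  ultimately show ?thesis by (simp add: base_family_def)
qed

lemma Plucker4_cong:
  assumes "\<And>S. card S = p \<Longrightarrow> U S = P S" "finite G"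
  shows "Plucker4 G p U \<longleftrightarrow> Plucker4 G p P"
  unfolding Plucker4_def
proof (intro all_cong1 imp_cong refl; elim conjE)
  fix i j k l X
  assume *: "i < j" "j < k" "k < l" "X \<subseteq> G - {i, j, k, l}" "card X + 2 = p"
  have fX: "finite X" using assms(2) *(4) finite_subset by blast
  have "U (X \<union> {a, b}) = P (X \<union> {a, b})" if "a \<in> {i, j, k, l}" "b \<in> {i, j, k, l}" "a \<noteq> b" for a b
  proof -
    have "a \<notin> X" "b \<notin> X" using * that by auto
    then show ?thesis using * that fX by (intro assms(1)) (simp add: card_insert_if)
  qed
  then show "(U (X \<union> {i, k}) * U (X \<union> {j, l}) = U (X \<union> {i, j}) * U (X \<union> {k, l}) + U (X \<union> {i, l}) * U (X \<union> {j, k})) =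
    (P (X \<union> {i, k}) * P (X \<union> {j, l}) = P (X \<union> {i, j}) * P (X \<union> {k, l}) + P (X \<union> {i, l}) * P (X \<union> {j, k}))"
    using * by simp
qed

lemma Plucker3_cong:
  assumes "\<And>S. card S = p \<or> card S = Suc p \<Longrightarrow> U S = P S" "finite G"
  shows "Plucker3 G p U \<longleftrightarrow> Plucker3 G p P"
  unfolding Plucker3_def
proof (intro all_cong1 imp_cong refl; elim conjE)
  fix i j k X
  assume *: "i < j" "j < k" "X \<subseteq> G - {i, j, k}" "card X + 1 = p"
  have fX: "finite X" using assms(2) *(3) finite_subset by blast
  have "U (X \<union> {a}) = P (X \<union> {a})" if "a \<in> {i, j, k}" for a
    using * that fX by (intro assms(1)) (auto simp: card_insert_if)
  moreover have "U (X \<union> {a, b}) = P (X \<union> {a, b})" if "a \<in> {i, j, k}" "b \<in> {i, j, k}" "a \<noteq> b" for a b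
  proof -
    have "a \<notin> X" "b \<notin> X" using * that by auto
    then show ?thesis using * that fX by (intro assms(1)) (simp add: card_insert_if)
  qed
  ultimately show "(U (X \<union> {i, k}) * U (X \<union> {j}) = U (X \<union> {i, j}) * U (X \<union> {k}) + U (X \<union> {i}) * U (X \<union> {j, k})) =
    (P (X \<union> {i, k}) * P (X \<union> {j}) = P (X \<union> {i, j}) * P (X \<union> {k}) + P (X \<union> {i}) * P (X \<union> {j, k}))"
    using * by simp
qed

text \<open>Deleting \<open>g\<close> identifies layer \<open>m + 1\<close> of \<open>{g..n}\<close> with the layers \<open>m\<close> and \<open>m + 1\<close> of
  \<open>{g + 1..n}\<close>; the four-index relation with smallest index \<open>g\<close> becomes the three-index one.\<close>

lemma positive_base_layer:
  fixes h :: "nat set \<Rightarrow> real"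
  assumes h: "\<And>S. 0 < h S"
  shows "\<exists>P. (\<forall>S. S \<subseteq> {g..n} \<and> card S = m \<longrightarrow> 0 < P S) \<and> Plucker4 {g..n} m P \<and>
    (\<forall>S \<in> base_family g n m. P S = h S)"
  using h
proof (induction m arbitrary: g h)
  case 0
  then show ?case by (intro exI[of _ h]) (auto simp: Plucker4_def)
next
  case (Suc m)
  \<comment> \<open>\<open>V T\<close> is meant as the value at \<open>insert g T\<close>. The
    extension \<open>U\<close> adds, on layer \<open>Suc m\<close>, the values at sets without
    \<open>g\<close>, and \<open>P\<close> glues the two.\<close>
  obtain V where V: "\<And>S. S \<subseteq> {Suc g..n} \<Longrightarrow> card S = m \<Longrightarrow> 0 < V S" "Plucker4 {Suc g..n} m V"
    "\<And>S. S \<in> base_family (Suc g) n m \<Longrightarrow> V S = h (insert g S)"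
    using Suc.IH[of "\<lambda>S. h (insert g S)" "Suc g"] Suc.prems by blast
  obtain U where U: "\<And>S. card S \<noteq> Suc m \<Longrightarrow> U S = V S"
    "\<And>S. S \<subseteq> {Suc g..n} \<Longrightarrow> card S = Suc m \<Longrightarrow> 0 < U S"
    "Plucker3 {Suc g..n} m U" "Plucker4 {Suc g..n} (Suc m) U"
    "\<And>c d. Suc g \<le> c \<Longrightarrow> d \<le> n \<Longrightarrow> card {c..d} = Suc m \<Longrightarrow> U {c..d} = h {c..d}"
    using layer_extension[of "Suc g" n m V h, OF V(1,2) Suc.prems] by blast
  have U4: "Plucker4 {Suc g..n} m U"
    using Plucker4_cong[of m U V "{Suc g..n}"] U(1) V(2) by simp
  define P where "P S = U (S - {g})" for S
  have sub: "S - {g} \<subseteq> {Suc g..n}" if "S \<subseteq> {g..n}" for S using that by fastforce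
  have "0 < P S" if "S \<subseteq> {g..n}" "card S = Suc m" for S
  proof (cases "g \<in> S")
    case True
    then have "card (S - {g}) = m" using that by (simp add: card_Diff_singleton)
    then show ?thesis using U(1) V(1)[OF sub[OF that(1)]] by (simp add: P_def)
  next
    case False
    then show ?thesis using U(2)[of S] sub[OF that(1)] that by (simp add: P_def)
  qed
  moreover have "P S = h S" if S: "S \<in> base_family g n (Suc m)" for S
  proof (cases "g \<in> S")
    case True
    have R: "S - {g} \<in> base_family (Suc g) n m" using base_family_remove[OF S True] .
    then have "card (S - {g}) = m" by (simp add: base_family_def)
    then show ?thesis using U(1) V(3)[OF R] True by (simp add: P_def insert_absorb)
  next
    case False
    \<comment> \<open>A two-block member of the family has nonempty first block
      \<open>{g..d1}\<close> and would contain \<open>g\<close>.\<close>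
    then obtain c d where cd: "S = {c..d}" using S by (auto simp: base_family_def)
    have S': "S \<subseteq> {g..n}" "card S = Suc m" using S by (auto simp: base_family_def)
    then have "c \<le> d" unfolding cd by (cases "c \<le> d") auto
    then have "Suc g \<le> c" "d \<le> n" using S' False unfolding cd by (auto simp: subset_iff not_less_eq_eq[symmetric])
    then show ?thesis using U(5)[of c d] S' False unfolding cd P_def by simp
  qed
  moreover have "Plucker4 {g..n} (Suc m) P"
    unfolding Plucker4_def
  proof (intro allI impI; elim conjE)
    fix i j k l X
    assume *: "i < j" "j < k" "k < l" "{i, j, k, l} \<subseteq> {g..n}" "X \<subseteq> {g..n} - {i, j, k, l}" "card X + 2 = Suc m"
    have fX: "finite X" using *(5) finite_subset by blast
    have g: "g \<noteq> j" "g \<noteq> k" "g \<noteq> l" "g \<le> i" using * by auto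
    show "P (X \<union> {i, k}) * P (X \<union> {j, l}) = P (X \<union> {i, j}) * P (X \<union> {k, l}) + P (X \<union> {i, l}) * P (X \<union> {j, k})"
    proof (cases "g = i")
      case True
      have X: "X \<subseteq> {Suc g..n} - {j, k, l}" using * True by fastforce
      have "X \<union> {g, k} - {g} = X \<union> {k}" "X \<union> {j, l} - {g} = X \<union> {j, l}" "X \<union> {g, j} - {g} = X \<union> {j}"
        "X \<union> {k, l} - {g} = X \<union> {k, l}" "X \<union> {g, l} - {g} = X \<union> {l}" "X \<union> {j, k} - {g} = X \<union> {j, k}"
        using X g by auto
      moreover have "{j, k, l} \<subseteq> {Suc g..n}" "card X + 1 = m" using * True by auto
      then have "U (X \<union> {j, l}) * U (X \<union> {k}) = U (X \<union> {j, k}) * U (X \<union> {l}) + U (X \<union> {j}) * U (X \<union> {k, l})"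
        by (intro Plucker3D[OF U(3)] X *)
      ultimately show ?thesis unfolding P_def True[symmetric] by (simp add: algebra_simps)
    next
      case False
      define Y where "Y = X - {g}"
      have Y: "Y \<subseteq> {Suc g..n} - {i, j, k, l}" using * unfolding Y_def by fastforce
      have e: "X \<union> {a, b} - {g} = Y \<union> {a, b}" if "a \<noteq> g" "b \<noteq> g" for a b
        using that Y_def by auto
      have sub: "{i, j, k, l} \<subseteq> {Suc g..n}" using * False by auto
      \<comment> \<open>The first alternative occurs when \<open>g\<close> is in \<open>X\<close>,
        the second when it is not; the relation is then taken from the corresponding layer of
        \<open>U\<close>.\<close>
      have "card Y + 2 = m \<or> card Y + 2 = Suc m"
        using *(6) fX by (cases "g \<in> X") (auto simp: Y_def card_Diff_singleton)
      then have "U (Y \<union> {i, k}) * U (Y \<union> {j, l}) = U (Y \<union> {i, j}) * U (Y \<union> {k, l}) + U (Y \<union> {i, l}) * U (Y \<union> {j, k})"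
        using Plucker4D[OF U4 *(1-3) sub Y] Plucker4D[OF U(4) *(1-3) sub Y] by blast
      then show ?thesis unfolding P_def using e g False by simp
    qed
  qed
  ultimately show ?case by blast
qed

lemma interval_basis_single: "interval_basis n m m \<subseteq> base_family 1 n m"
proof
  fix S assume S: "S \<in> interval_basis n m m"
  then consider "S \<in> sesqui_intervals n m" | "S \<in> intervals n m"
    by (auto simp: interval_basis_def)
  then show "S \<in> base_family 1 n m"
  proof cases
    case 1
    then obtain d1 c2 d2 where "1 \<le> d1" "d1 + 1 < c2" "c2 \<le> d2" "d2 \<le> n" "S = {1..d1} \<union> {c2..d2}" "card S = m"
      unfolding sesqui_intervals_def by blast
    moreover from this have "S \<subseteq> {1..n}" by auto
    ultimately show ?thesis unfolding base_family_def by blast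
  next
    case 2
    then show ?thesis by (auto simp: intervals_def base_family_def)
  qed
qed

text \<open>The bottom layer comes from \<open>positive_base_layer\<close>; every further layer is
  put on by \<open>layer_extension\<close>. Sesqui-intervals have size \<open>m\<close>, so above
  the bottom only intervals are prescribed.\<close>

lemma positive_layers:
  fixes h :: "nat set \<Rightarrow> real"
  assumes h: "\<And>S. 0 < h S" and m: "m \<le> m'"
  shows "\<exists>P. (\<forall>S \<in> layers n m m'. 0 < P S) \<and> (\<forall>p. m \<le> p \<and> p \<le> m' \<longrightarrow> Plucker4 {1..n} p P) \<and>
    (\<forall>p. m \<le> p \<and> p < m' \<longrightarrow> Plucker3 {1..n} p P) \<and>
    (\<forall>S \<in> interval_basis n m m'. P S = h S) \<and> (m = 0 \<longrightarrow> P {} = h {})"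
  using m
proof (induction m' rule: dec_induct)
  case base
  obtain P where P: "\<forall>S. S \<subseteq> {1..n} \<and> card S = m \<longrightarrow> 0 < P S" "Plucker4 {1..n} m P"
    "\<forall>S \<in> base_family 1 n m. P S = h S"
    using positive_base_layer[of h 1 n m] h by (elim meta_impE exE conjE) auto
  \<comment> \<open>As \<open>{1..0}\<close> the empty set belongs to the loose family, so its value
    can be prescribed when \<open>m = 0\<close>, although it is no basis element.\<close>
  have "{} \<in> base_family 1 n 0" by (auto simp: base_family_def intro: exI[of _ 1] exI[of _ 0])
  with P interval_basis_single[of n m] show ?case
    by (intro exI[of _ P]) (auto simp: layers_def)
next
  case (step q)
  then obtain P where P: "\<And>S. S \<in> layers n m q \<Longrightarrow> 0 < P S" "\<And>p. m \<le> p \<Longrightarrow> p \<le> q \<Longrightarrow> Plucker4 {1..n} p P"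
    "\<And>p. m \<le> p \<Longrightarrow> p < q \<Longrightarrow> Plucker3 {1..n} p P" "\<And>S. S \<in> interval_basis n m q \<Longrightarrow> P S = h S"
    "m = 0 \<Longrightarrow> P {} = h {}"
    by blast
  have "0 < P S" if "S \<subseteq> {1..n}" "card S = q" for S
    using P(1) that step.hyps by (simp add: layers_def)
  from layer_extension[of 1 n q P h, OF this P(2) h]
  obtain U where U: "\<And>S. card S \<noteq> Suc q \<Longrightarrow> U S = P S"
    "\<And>S. S \<subseteq> {1..n} \<Longrightarrow> card S = Suc q \<Longrightarrow> 0 < U S"
    "Plucker3 {1..n} q U" "Plucker4 {1..n} (Suc q) U"
    "\<And>c d. 1 \<le> c \<Longrightarrow> d \<le> n \<Longrightarrow> card {c..d} = Suc q \<Longrightarrow> U {c..d} = h {c..d}"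
    using step.hyps by blast
  have "0 < U S" if "S \<in> layers n m (Suc q)" for S
    using that U(1)[of S] U(2)[of S] P(1)[of S] by (cases "card S = Suc q") (auto simp: layers_def)
  moreover have "Plucker4 {1..n} p U" if "m \<le> p" "p \<le> Suc q" for p
    using that U(4) P(2)[of p] Plucker4_cong[of p U P "{1..n}"] U(1) by (cases "p = Suc q") auto
  moreover have "Plucker3 {1..n} p U" if "m \<le> p" "p < Suc q" for p
  proof (cases "p = q")
    case False
    then have "p < q" using that by simp
    then have "U S = P S" if "card S = p \<or> card S = Suc p" for S using U(1) that by auto
    with Plucker3_cong[of p U P "{1..n}"] P(3)[OF that(1) \<open>p < q\<close>] show ?thesis by blast
  qed (use U(3) in simp)
  moreover have "U S = h S" if "S \<in> interval_basis n m (Suc q)" for S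
  proof (cases "card S = Suc q")
    case True
    then have "S \<notin> sesqui_intervals n m" using step.hyps by (auto simp: sesqui_intervals_def)
    then show ?thesis
      using that True U(5) by (auto simp: interval_basis_def intervals_def)
  next
    case False
    then have "S \<in> interval_basis n m q"
      using that by (auto simp: interval_basis_def intervals_def)
    then show ?thesis using P(4) U(1) False by simp
  qed
  moreover have "m = 0 \<longrightarrow> U {} = h {}" using U(1) P(5) by simp
  ultimately show ?case by blast
qed

section \<open>TP relations by cardinality, and exponential growth rates\<close>

text \<open>The six sets have \<open>card X + 1\<close> or \<open>card X + 2\<close> elements, so
  their membership in the layers becomes one lower and one upper bound on
  \<open>card X\<close>.\<close>

lemma TP3_layers_iff:
  "TP3 n (layers n m m') f \<longleftrightarrow>
    (\<forall>i j k X. 1 \<le> i \<and> i < j \<and> j < k \<and> k \<le> n \<and> X \<subseteq> {1..n} - {i, j, k} \<and> m \<le> card X + 1 \<and> card X + 2 \<le> m' \<longrightarrow>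
       f (X \<union> {i, k}) + f (X \<union> {j}) =
         max (f (X \<union> {i, j}) + f (X \<union> {k})) (f (X \<union> {i}) + f (X \<union> {j, k})))"
proof -
  have "(i \<in> {1..n} \<and> j \<in> {1..n} \<and> k \<in> {1..n} \<and> i < j \<and> j < k \<and> X \<subseteq> {1..n} - {i, j, k} \<and>
       {X \<union> {i, k}, X \<union> {j}, X \<union> {i, j}, X \<union> {k}, X \<union> {i}, X \<union> {j, k}} \<subseteq> layers n m m') \<longleftrightarrow>
    (1 \<le> i \<and> i < j \<and> j < k \<and> k \<le> n \<and> X \<subseteq> {1..n} - {i, j, k} \<and> m \<le> card X + 1 \<and> card X + 2 \<le> m')" for i j k X
  proof -
    have "card (X \<union> {i, k}) = card X + 2" "card (X \<union> {i, j}) = card X + 2" "card (X \<union> {j, k}) = card X + 2"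
      "card (X \<union> {i}) = card X + 1" "card (X \<union> {j}) = card X + 1" "card (X \<union> {k}) = card X + 1"
      if "X \<subseteq> {1..n} - {i, j, k}" "i < j" "j < k"
      using that finite_subset[OF that(1)] by (auto simp: card_insert_if)
    then show ?thesis unfolding layers_def by auto
  qed
  then show ?thesis unfolding TP3_def by (simp only:)
qed

lemma TP4_layers_iff:
  "TP4 n (layers n m m') f \<longleftrightarrow>
    (\<forall>i j k l X. 1 \<le> i \<and> i < j \<and> j < k \<and> k < l \<and> l \<le> n \<and> X \<subseteq> {1..n} - {i, j, k, l} \<and>
       m \<le> card X + 2 \<and> card X + 2 \<le> m' \<longrightarrow>
       f (X \<union> {i, k}) + f (X \<union> {j, l}) =
         max (f (X \<union> {i, j}) + f (X \<union> {k, l})) (f (X \<union> {i, l}) + f (X \<union> {j, k})))"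
proof -
  have "(i \<in> {1..n} \<and> j \<in> {1..n} \<and> k \<in> {1..n} \<and> l \<in> {1..n} \<and> i < j \<and> j < k \<and> k < l \<and> X \<subseteq> {1..n} - {i, j, k, l} \<and>
       {X \<union> {i, k}, X \<union> {j, l}, X \<union> {i, j}, X \<union> {k, l}, X \<union> {i, l}, X \<union> {j, k}} \<subseteq> layers n m m') \<longleftrightarrow>
    (1 \<le> i \<and> i < j \<and> j < k \<and> k < l \<and> l \<le> n \<and> X \<subseteq> {1..n} - {i, j, k, l} \<and> m \<le> card X + 2 \<and> card X + 2 \<le> m')" for i j k l X
  proof -
    have "card (X \<union> {i, k}) = card X + 2" "card (X \<union> {i, j}) = card X + 2" "card (X \<union> {j, k}) = card X + 2"
      "card (X \<union> {j, l}) = card X + 2" "card (X \<union> {i, l}) = card X + 2" "card (X \<union> {k, l}) = card X + 2"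
      if "X \<subseteq> {1..n} - {i, j, k, l}" "i < j" "j < k" "k < l"
      using that finite_subset[OF that(1)] by (auto simp: card_insert_if)
    then show ?thesis unfolding layers_def by auto
  qed
  then show ?thesis unfolding TP4_def by (simp only:)
qed

text \<open>For positive sequences this rate takes products to sums and sums to maxima, which turns
  Pluecker relations into TP relations (Maslov dequantization).\<close>

definition exp_growth :: "(nat \<Rightarrow> real) \<Rightarrow> real \<Rightarrow> bool" where
  "exp_growth x a \<longleftrightarrow> (\<lambda>t. ln (x t) / real t) \<longlonglongrightarrow> a"

lemma exp_growth_unique: "exp_growth x a \<Longrightarrow> exp_growth x b \<Longrightarrow> a = b"
  unfolding exp_growth_def by (rule LIMSEQ_unique)

lemma exp_growth_mult:
  assumes "exp_growth x a" "exp_growth y b" "\<And>t. 0 < x t" "\<And>t. 0 < y t"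
  shows "exp_growth (\<lambda>t. x t * y t) (a + b)"
  using tendsto_add[OF assms(1,2)[unfolded exp_growth_def]] assms(3,4)
  unfolding exp_growth_def by (simp add: ln_mult_pos add_divide_distrib)

text \<open>The sum lies between the larger summand and twice it, and \<open>ln 2 / t\<close> tends
  to 0.\<close>

lemma exp_growth_add:
  assumes "exp_growth x a" "exp_growth y b" and pos: "\<And>t. 0 < x t" "\<And>t. 0 < y t"
  shows "exp_growth (\<lambda>t. x t + y t) (max a b)"
  unfolding exp_growth_def
proof (rule tendsto_sandwich)
  let ?M = "\<lambda>t. max (ln (x t) / real t) (ln (y t) / real t)"
  show M: "?M \<longlonglongrightarrow> max a b"
    using assms(1,2) unfolding exp_growth_def by (rule tendsto_max)
  have "(\<lambda>t. ln 2 / real t) \<longlonglongrightarrow> 0" by (rule lim_const_over_n)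
  from tendsto_add[OF this M] show "(\<lambda>t. ln 2 / real t + ?M t) \<longlonglongrightarrow> max a b" by simp
  have le: "ln (x t) \<le> ln (x t + y t)" "ln (y t) \<le> ln (x t + y t)" for t
    using pos[of t] by auto
  show "\<forall>\<^sub>F t in sequentially. ?M t \<le> ln (x t + y t) / real t"
    using le by (intro always_eventually allI) (simp add: divide_right_mono)
  have "ln (x t + y t) \<le> ln 2 + max (ln (x t)) (ln (y t))" for t
  proof -
    have "ln (x t + y t) \<le> ln (2 * max (x t) (y t))" using pos[of t] by (subst ln_le_cancel_iff) auto
    also have "\<dots> = ln 2 + ln (max (x t) (y t))" using pos[of t] by (intro ln_mult_pos) auto
    also have "\<dots> \<le> ln 2 + max (ln (x t)) (ln (y t))" by (simp add: max_def)
    finally show ?thesis .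
  qed
  then have "ln (x t + y t) / real t \<le> (ln 2 + max (ln (x t)) (ln (y t))) / real t" for t
    by (intro divide_right_mono) auto
  moreover have "max (ln (x t)) (ln (y t)) / real t = ?M t" for t
    by (simp add: max_divide_distrib_right)
  ultimately show "\<forall>\<^sub>F t in sequentially. ln (x t + y t) / real t \<le> ln 2 / real t + ?M t"
    by (intro always_eventually allI) (simp add: add_divide_distrib)
qed

text \<open>That \<open>x\<close> has a growth rate at all is part of the conclusion; this is what
  allows rates to be propagated from the basis.\<close>

lemma exp_growth_relation:
  assumes "exp_growth y b" "exp_growth p c" "exp_growth q d" "exp_growth r c'" "exp_growth s d'"
    and pos: "\<And>t. 0 < x t" "\<And>t. 0 < y t" "\<And>t. 0 < p t" "\<And>t. 0 < q t" "\<And>t. 0 < r t" "\<And>t. 0 < s t"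
    and eq: "\<And>t. x t * y t = p t * q t + r t * s t"
  shows "exp_growth x (max (c + d) (c' + d') - b)"
proof -
  have "exp_growth (\<lambda>t. x t * y t) (max (c + d) (c' + d'))"
    unfolding eq using assms(2-5) pos by (intro exp_growth_add exp_growth_mult) auto
  from tendsto_diff[OF this[unfolded exp_growth_def] assms(1)[unfolded exp_growth_def]]
  show ?thesis unfolding exp_growth_def using pos by (simp add: ln_mult_pos add_divide_distrib)
qed

lemma pair_in_layers:
  assumes "X \<subseteq> {1..n} - I" "m \<le> card X + 2" "card X + 2 \<le> m'" "a \<in> I" "b \<in> I" "a \<noteq> b" "I \<subseteq> {1..n}"
  shows "X \<union> {a, b} \<in> layers n m m'"
proof -
  have "finite X" "a \<notin> X" "b \<notin> X" using assms finite_subset by blast+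
  then show ?thesis using assms by (auto simp: layers_def)
qed

lemma singleton_in_layers:
  assumes "X \<subseteq> {1..n} - I" "m \<le> card X + 1" "card X + 2 \<le> m'" "a \<in> I" "I \<subseteq> {1..n}"
  shows "X \<union> {a} \<in> layers n m m'"
proof -
  have "finite X" "a \<notin> X" using assms finite_subset by blast+
  then show ?thesis using assms by (auto simp: layers_def)
qed

lemma interval_basis_subset: "m \<le> m' \<Longrightarrow> interval_basis n m m' \<subseteq> layers n m m'"
  by (auto simp: interval_basis_def intervals_def sesqui_intervals_def layers_def)

section \<open>Uniqueness and existence of a TP-function with given basis values\<close>

text \<open>\<open>layers_generation\<close> applied to agreement of \<open>f\<close> and
  \<open>g\<close>: when five of the six values in a TP relation agree and the sixth stands on the
  left, subtraction gives agreement there too. The normalization covers the empty set.\<close>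

lemma TP_functions_determined:
  assumes f: "f \<in> TP_functions n m m'" and g: "g \<in> TP_functions n m m'"
    and eq: "\<And>S. S \<in> interval_basis n m m' \<Longrightarrow> f S = g S"
  shows "f = g"
proof (rule PiE_ext)
  show "f \<in> layers n m m' \<rightarrow>\<^sub>E UNIV" "g \<in> layers n m m' \<rightarrow>\<^sub>E UNIV"
    using f g by (auto simp: TP_functions_def)
  have T: "TP3 n (layers n m m') f" "TP3 n (layers n m m') g" "TP4 n (layers n m m') f" "TP4 n (layers n m m') g"
    using f g by (auto simp: TP_functions_def)
  fix S assume "S \<in> layers n m m'"
  then show "f S = g S"
  proof (rule layers_generation)
    show "f {} = g {}" if "m = 0" using that f g by (auto simp: TP_functions_def)
  next
    fix i j k X
    assume *: "1 \<le> i" "i < j" "j < k" "k \<le> n" "X \<subseteq> {1..n} - {i, j, k}" "m \<le> card X + 1" "card X + 2 \<le> m'"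
      and e: "f (X \<union> {j}) = g (X \<union> {j})" "f (X \<union> {i, j}) = g (X \<union> {i, j})" "f (X \<union> {k}) = g (X \<union> {k})"
        "f (X \<union> {i}) = g (X \<union> {i})" "f (X \<union> {j, k}) = g (X \<union> {j, k})"
    have "f (X \<union> {i, k}) + f (X \<union> {j}) = max (f (X \<union> {i, j}) + f (X \<union> {k})) (f (X \<union> {i}) + f (X \<union> {j, k}))"
      "g (X \<union> {i, k}) + g (X \<union> {j}) = max (g (X \<union> {i, j}) + g (X \<union> {k})) (g (X \<union> {i}) + g (X \<union> {j, k}))"
      by (rule T[unfolded TP3_layers_iff, rule_format], use * in blast)+
    then show "f (X \<union> {i, k}) = g (X \<union> {i, k})" unfolding e by linarith
  next
    fix i j k l X
    assume *: "1 \<le> i" "i < j" "j < k" "k < l" "l \<le> n" "X \<subseteq> {1..n} - {i, j, k, l}" "m \<le> card X + 2" "card X + 2 \<le> m'"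
      and e: "f (X \<union> {i, k}) = g (X \<union> {i, k})" "f (X \<union> {i, j}) = g (X \<union> {i, j})" "f (X \<union> {k, l}) = g (X \<union> {k, l})"
        "f (X \<union> {i, l}) = g (X \<union> {i, l})" "f (X \<union> {j, k}) = g (X \<union> {j, k})"
    have "f (X \<union> {i, k}) + f (X \<union> {j, l}) = max (f (X \<union> {i, j}) + f (X \<union> {k, l})) (f (X \<union> {i, l}) + f (X \<union> {j, k}))"
      "g (X \<union> {i, k}) + g (X \<union> {j, l}) = max (g (X \<union> {i, j}) + g (X \<union> {k, l})) (g (X \<union> {i, l}) + g (X \<union> {j, k}))"
      by (rule T[unfolded TP4_layers_iff, rule_format], use * in blast)+
    then show "f (X \<union> {j, l}) = g (X \<union> {j, l})" unfolding e by linarith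
  qed (rule eq)
qed

lemma TP_functions_interpolation:
  assumes m: "m \<le> m'"
  obtains f where "f \<in> TP_functions n m m'" "\<And>S. S \<in> interval_basis n m m' \<Longrightarrow> f S = h S"
proof -
  let ?C = "layers n m m'" and ?B = "interval_basis n m m'"
  \<comment> \<open>The exponent 0 at the empty set makes the limit function satisfy the
    normalization for \<open>m = 0\<close>; on the basis, whose sets are nonempty, \<open>h'\<close>
    is \<open>h\<close>.\<close>
  define h' where "h' S = (if S = {} then 0 else h S)" for S
  let ?good = "\<lambda>t P. (\<forall>S \<in> ?C. 0 < P S) \<and> (\<forall>p. m \<le> p \<and> p \<le> m' \<longrightarrow> Plucker4 {1..n} p P) \<and>
    (\<forall>p. m \<le> p \<and> p < m' \<longrightarrow> Plucker3 {1..n} p P) \<and>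
    (\<forall>S \<in> ?B. P S = exp (real t * h' S)) \<and> (m = 0 \<longrightarrow> P {} = exp (real t * h' {}))"
  have "\<exists>P. ?good t P" for t
    by (rule positive_layers) (simp_all add: m)
  then have "\<exists>P. \<forall>t. ?good t (P t)" by (intro choice allI)
  then obtain P where pos: "\<And>t S. S \<in> ?C \<Longrightarrow> 0 < P t S"
    and P4: "\<And>t p. m \<le> p \<Longrightarrow> p \<le> m' \<Longrightarrow> Plucker4 {1..n} p (P t)"
    and P3: "\<And>t p. m \<le> p \<Longrightarrow> p < m' \<Longrightarrow> Plucker3 {1..n} p (P t)"
    and PB: "\<And>t S. S \<in> ?B \<Longrightarrow> P t S = exp (real t * h' S)"
    and P0: "\<And>t. m = 0 \<Longrightarrow> P t {} = exp (real t * h' {})"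
    by blast
  define G where "G S a \<longleftrightarrow> exp_growth (\<lambda>t. P t S) a" for S a
  \<comment> \<open>The quotient equals \<open>h' S\<close> for every \<open>t\<close> from 1 on; at
    \<open>t = 0\<close> the division returns 0, which the limit ignores.\<close>
  have exp: "G S (h' S)" if "\<And>t. P t S = exp (real t * h' S)" for S
    unfolding G_def exp_growth_def that
    by (intro tendsto_eventually eventually_sequentiallyI[of 1]) simp
  have G3: "G (X \<union> {i, k}) (max (c + d) (c' + d') - b)"
    if "1 \<le> i" "i < j" "j < k" "k \<le> n" "X \<subseteq> {1..n} - {i, j, k}" "m \<le> card X + 1" "card X + 2 \<le> m'"
      "G (X \<union> {j}) b" "G (X \<union> {i, j}) c" "G (X \<union> {k}) d" "G (X \<union> {i}) c'" "G (X \<union> {j, k}) d'"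
    for i j k X b c d c' d'
  proof -
    have I: "{i, j, k} \<subseteq> {1..n}" using that by auto
    have "P t (X \<union> {i, k}) * P t (X \<union> {j}) = P t (X \<union> {i, j}) * P t (X \<union> {k}) + P t (X \<union> {i}) * P t (X \<union> {j, k})" for t
      by (rule Plucker3D[OF P3]) (use that I in auto)
    then show ?thesis
      using that(2,3) I unfolding G_def
      by (intro exp_growth_relation[OF that(8-12)[unfolded G_def]] pos
          pair_in_layers[OF that(5)] singleton_in_layers[OF that(5)]) (use that(6,7) in auto)
  qed
  have G4: "G (X \<union> {j, l}) (max (c + d) (c' + d') - b)"
    if "1 \<le> i" "i < j" "j < k" "k < l" "l \<le> n" "X \<subseteq> {1..n} - {i, j, k, l}" "m \<le> card X + 2" "card X + 2 \<le> m'"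
      "G (X \<union> {i, k}) b" "G (X \<union> {i, j}) c" "G (X \<union> {k, l}) d" "G (X \<union> {i, l}) c'" "G (X \<union> {j, k}) d'"
    for i j k l X b c d c' d'
  proof -
    have I: "{i, j, k, l} \<subseteq> {1..n}" using that by auto
    have "P t (X \<union> {i, k}) * P t (X \<union> {j, l}) =
        P t (X \<union> {i, j}) * P t (X \<union> {k, l}) + P t (X \<union> {i, l}) * P t (X \<union> {j, k})" for t
      by (rule Plucker4D[OF P4]) (use that I in auto)
    then have "P t (X \<union> {j, l}) * P t (X \<union> {i, k}) =
        P t (X \<union> {i, j}) * P t (X \<union> {k, l}) + P t (X \<union> {i, l}) * P t (X \<union> {j, k})" for t
      by (simp add: mult.commute)
    then show ?thesis
      using that(2-4) I unfolding G_def
      by (intro exp_growth_relation[OF that(9-13)[unfolded G_def]] pos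
          pair_in_layers[OF that(6)]) (use that(7,8) in auto)
  qed
  \<comment> \<open>Convergence spreads from the basis along the same reduction that gave
    injectivity; \<open>G3\<close> and \<open>G4\<close> are the two reduction steps.\<close>
  have "\<exists>a. G S a" if "S \<in> ?C" for S
    using that
  proof (rule layers_generation)
    show "\<exists>a. G {} a" if "m = 0" using exp P0 that by blast
    show "\<exists>a. G S a" if "S \<in> ?B" for S using exp PB that by blast
  qed (elim exE, rule exI, rule G3 G4; assumption)+
  then obtain L where L: "\<And>S. S \<in> ?C \<Longrightarrow> G S (L S)" by metis
  have unique: "G S a \<Longrightarrow> G S b \<Longrightarrow> a = b" for S a b
    unfolding G_def by (rule exp_growth_unique)
  define f where "f = restrict L ?C"
  have f: "G S (f S)" if "S \<in> ?C" for S using L that by (simp add: f_def)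
  have fh: "f S = h' S" if "S \<in> ?B" for S
    using unique[OF f exp] that PB interval_basis_subset[OF m] by blast
  have "TP3 n ?C f"
    unfolding TP3_layers_iff
  proof (intro allI impI; elim conjE)
    fix i j k X
    assume *: "1 \<le> i" "i < j" "j < k" "k \<le> n" "X \<subseteq> {1..n} - {i, j, k}" "m \<le> card X + 1" "card X + 2 \<le> m'"
    have I: "{i, j, k} \<subseteq> {1..n}" using * by auto
    have one: "G (X \<union> {a}) (f (X \<union> {a}))" if "a \<in> {i, j, k}" for a
      by (rule f, rule singleton_in_layers[OF *(5)]) (use that * I in auto)
    have two: "G (X \<union> {a, b}) (f (X \<union> {a, b}))" if "a \<in> {i, j, k}" "b \<in> {i, j, k}" "a \<noteq> b" for a b
      by (rule f, rule pair_in_layers[OF *(5)]) (use that * I in auto)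
    \<comment> \<open>Both sides are growth rates of the same sequence, so uniqueness of limits
      yields the TP relation.\<close>
    have "f (X \<union> {i, k}) = max (f (X \<union> {i, j}) + f (X \<union> {k})) (f (X \<union> {i}) + f (X \<union> {j, k})) - f (X \<union> {j})"
      by (rule unique[OF two G3[OF *]]) (use one two * in auto)
    then show "f (X \<union> {i, k}) + f (X \<union> {j}) = max (f (X \<union> {i, j}) + f (X \<union> {k})) (f (X \<union> {i}) + f (X \<union> {j, k}))"
      by simp
  qed
  moreover have "TP4 n ?C f"
    unfolding TP4_layers_iff
  proof (intro allI impI; elim conjE)
    fix i j k l X
    assume *: "1 \<le> i" "i < j" "j < k" "k < l" "l \<le> n" "X \<subseteq> {1..n} - {i, j, k, l}" "m \<le> card X + 2" "card X + 2 \<le> m'"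
    have I: "{i, j, k, l} \<subseteq> {1..n}" using * by auto
    have two: "G (X \<union> {a, b}) (f (X \<union> {a, b}))" if "a \<in> {i, j, k, l}" "b \<in> {i, j, k, l}" "a \<noteq> b" for a b
      by (rule f, rule pair_in_layers[OF *(6)]) (use that * I in auto)
    have "f (X \<union> {j, l}) = max (f (X \<union> {i, j}) + f (X \<union> {k, l})) (f (X \<union> {i, l}) + f (X \<union> {j, k})) - f (X \<union> {i, k})"
      by (rule unique[OF two G4[OF *]]) (use two * in auto)
    then show "f (X \<union> {i, k}) + f (X \<union> {j, l}) = max (f (X \<union> {i, j}) + f (X \<union> {k, l})) (f (X \<union> {i, l}) + f (X \<union> {j, k}))"
      by simp
  qed
  moreover have "f {} = 0" if "m = 0"
  proof -
    have "{} \<in> ?C" using that by (simp add: layers_def)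
    then have "f {} = h' {}" using unique[OF f exp] P0 that by blast
    then show ?thesis by (simp add: h'_def)
  qed
  ultimately have "f \<in> TP_functions n m m'" by (simp add: TP_functions_def f_def)
  moreover have "f S = h S" if "S \<in> ?B" for S
  proof -
    have "S \<noteq> {}" using that by (auto simp: interval_basis_def intervals_def sesqui_intervals_def)
    then show ?thesis using fh[OF that] by (simp add: h'_def)
  qed
  ultimately show thesis by (rule that)
qed

theorem mainTheorem2:
  fixes n m m' :: nat
  assumes "0 \<le> m" and "m \<le> m'" and "m' \<le> n"
  shows "TP_basis n m m' (interval_basis n m m')"
  unfolding TP_basis_def
proof (intro conjI)
  let ?B = "interval_basis n m m'"
  show "?B \<subseteq> layers n m m'" using assms(2) by (rule interval_basis_subset)
  show "bij_betw (\<lambda>f. restrict f ?B) (TP_functions n m m') (?B \<rightarrow>\<^sub>E UNIV)"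
  proof (rule bij_betw_imageI)
    show "inj_on (\<lambda>f. restrict f ?B) (TP_functions n m m')"
      by (intro inj_onI TP_functions_determined) (assumption | metis restrict_apply')+
    show "(\<lambda>f. restrict f ?B) ` TP_functions n m m' = ?B \<rightarrow>\<^sub>E UNIV"
    proof (intro equalityI subsetI)
      fix h :: "nat set \<Rightarrow> real" assume h: "h \<in> ?B \<rightarrow>\<^sub>E UNIV"
      obtain f where f: "f \<in> TP_functions n m m'" "\<And>S. S \<in> ?B \<Longrightarrow> f S = h S"
        using TP_functions_interpolation[OF assms(2)] by blast
      have "restrict f ?B = h"
        by (rule PiE_ext[OF _ h]) (use f in auto)
      with f(1) show "h \<in> (\<lambda>f. restrict f ?B) ` TP_functions n m m'" by blast
    qed auto
  qed
qed

end
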